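(* Assume the setting described in the context. Suppose that for every object $X$ and all morphisms $\phi:\overline{F}^{*}X\multimap\overline{F}^{*}X$ and $\psi:\overline{F_\tau}X\multimap\overline{F_\tau}X$ in $\mathcal{K}l(T)$, if $\psi\cdot h_X=h_X\cdot\phi$ then $\psi^{*}\cdot h_X=h_X\cdot\phi^{*}$. Let $\alpha:X\multimap\overline{F_\tau}X$. Then every bisimulation on the $TF^*$-coalgebra $\underline{\alpha}^{\divideontimes}:X\to TF^*X$ is a bisimulation on the $TF_\tau$-coalgebra $\alpha^{\bigstar}:X\to TF_\tau X$.
   Context: Let $\mathsf{C}$ be a category with binary coproducts and $(T,\mu,\eta)$ a monad on $\mathsf{C}$. In the Kleisli category $\mathcal{K}l(T)$ (objects of $\mathsf{C}$; morphisms $X\multimap Y$ are $\mathsf{C}$-morphisms $X\to TY$; composition $g\cdot f=\mu_Z\circ Tg\circ f$; identity $1_X=\eta_X$) write $f^\sharp=\eta_Y\circ f$ for $f:X\to Y$ in $\mathsf{C}$; coproducts of $\mathcal{K}l(T)$ are those of $\mathsf{C}$, with coprojections $\iota^1,\iota^2$ and cotupling $[-,-]$. $\mathcal{K}l(T)$ is order-enriched (hom-sets are posets, composition monotone) and $T$ is an order saturation monad: for every $\alpha:X\multimap X$ there is $\alpha^{*}:X\multimap X$ with (a) $1\le\alpha^*$, (b) $\alpha\le\alpha^*$, (c) $\alpha^*\cdot\alpha^*\le\alpha^*$, (d) if $\beta:X\multimap X$ satisfies $1\le\beta$, $\alpha\le\beta$, $\beta\cdot\beta\le\beta$ then $\alpha^*\le\beta$,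 (e) for all $f:X\to Y$ in $\mathsf{C}$, $\beta:Y\multimap Y$ and $\Box\in\{\le,\ge\}$: $f^\sharp\cdot\alpha\mathrel{\Box}\beta\cdot f^\sharp$ implies $f^\sharp\cdot\alpha^*\mathrel{\Box}\beta^*\cdot f^\sharp$. A functor $S$ on $\mathsf{C}$ lifts to $\overline{S}$ on $\mathcal{K}l(T)$ if $\overline{S}X=SX$ and $\overline{S}(f^\sharp)=(Sf)^\sharp$; if $(\overline{S},m,e)$ is a monad on $\mathcal{K}l(T)$ then $TS$ is a monad on $\mathsf{C}$ whose Kleisli category is $\mathcal{K}l(\overline{S})$, with hom-sets $Hom_{\mathcal{K}l(T)}(X,\overline{S}Y)$ ordered as in $\mathcal{K}l(T)$. Standing assumptions: $\mathcal{K}l(T)$ has zero morphisms $0_{X,Y}$ (with $f\cdot 0=0=0\cdot g$). $F:\mathsf{C}\to\mathsf{C}$ lifts to $\overline{F}$, so $F_\tau=F+\mathcal{I}d$ lifts to $\overline{F_\tau}=\overline{F}+\mathcal{I}d$, which is a monad $(\overline{F_\tau},m',e')$ on $\mathcal{K}l(T)$ with $e'_X=\iota^2:X\multimap\overline{F}X+X$ and $m'_X=[\iota^1,id]\cdot(\overline{F}([0,id])+id):\overline{F}(\overline{F}X+X)+(\overline{F}X+X)\multimap\overline{F}X+X$. $F$ admits all free $F$-algebras, giving the free monad $F^*$ on $\mathsf{C}$; it lifts to $\overline{F}^*$ on $\mathcal{K}l(T)$ and $(\overline{F}^*,m,e)$ is the free monad over $\overline{F}$ in $\mathcal{K}l(T)$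 with universal natural transformation $\nu:\overline{F}\Rightarrow\overline{F}^*$. For both $(\overline{S},m,e)=(\overline{F_\tau},m',e')$ and $(\overline{S},m,e)=(\overline{F}^*,m,e)$, $\overline{S}$ is locally monotonic and $m_X\cdot\overline{S}[(m_X\cdot\overline{S}\alpha)^*\cdot e_X]=(m_X\cdot\overline{S}\alpha)^*$ for all $\alpha:X\multimap\overline{S}X$. For $\alpha:X\multimap\overline{F_\tau}X$ put $\alpha^{\bigstar}=(m'_X\cdot\overline{F_\tau}\alpha)^*\cdot e'_X$, and for $\beta:Y\multimap\overline{F}^*Y$ put $\beta^{\divideontimes}=(m_Y\cdot\overline{F}^*\beta)^*\cdot e_Y$ (these are saturation operators making $TF_\tau$ and $TF^*$ order saturation monads). $h:\overline{F}^*\Rightarrow\overline{F_\tau}$ is the unique monad morphism on $\mathcal{K}l(T)$ with $h\cdot\nu=\iota^1$ (it also satisfies $h\cdot e=e'$). For $\alpha:X\multimap\overline{F_\tau}X$ let $\underline{\alpha}=[\nu_X,e_X]\cdot\alpha:X\multimap\overline{F}^*X$. Bisimulation (kernel bisimulation): for an endofunctor $G$ on $\mathsf{C}$ and $G$-coalgebras $\alpha:X\to GX$, $\beta:Y\to GY$, a jointly monic span $X\xleftarrow{\pi_1}R\xrightarrow{\pi_2}Y$ is a bisimulation if there exist a $G$-coalgebra $\gamma:Z\to GZ$ and coalgebra homomorphisms $f$ from $\alpha$ to $\gamma$ and $g$ from $\beta$ to $\gamma$ (i.e. $Gf\circ\alpha=\gamma\circ f$, $Gg\circ\beta=\gamma\circ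 g$) such that $(R,\pi_1,\pi_2)$ is the pullback of $X\xrightarrow{f}Z\xleftarrow{g}Y$. A bisimulation on a coalgebra $\alpha$ is a bisimulation between $\alpha$ and itself. *)

theory Defs
  imports Main
begin

section \<open>Categories, endofunctors, monads\<close>

text \<open>
  Hom-sets form a family indexed by pairs of objects and need not be disjoint, so
  composition carries its three objects: \<open>Comp C X Y Z g f\<close> is the composite of
  \<open>f : X \<rightarrow> Y\<close> and \<open>g : Y \<rightarrow> Z\<close>. In this way the Kleisli category of a monad on \<open>C\<close>
  is again a category over the same two types (the object \<open>Z\<close> cannot be read off a morphism
  \<open>Y \<rightarrow> T Z\<close>), and all notions below apply to it verbatim. Only values at elements of
  \<open>Obj\<close> and \<open>Hom\<close> are meaningful.
\<close>

record ('o, 'a) cat =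
  Obj :: "'o set"
  Hom :: "'o \<Rightarrow> 'o \<Rightarrow> 'a set"
  Comp :: "'o \<Rightarrow> 'o \<Rightarrow> 'o \<Rightarrow> 'a \<Rightarrow> 'a \<Rightarrow> 'a"
  Ident :: "'o \<Rightarrow> 'a"

locale category =
  fixes C :: "('o, 'a) cat"
  assumes ident_in_hom: "X \<in> Obj C \<Longrightarrow> Ident C X \<in> Hom C X X"
    and comp_in_hom: "\<lbrakk>X \<in> Obj C; Y \<in> Obj C; Z \<in> Obj C; f \<in> Hom C X Y; g \<in> Hom C Y Z\<rbrakk>
      \<Longrightarrow> Comp C X Y Z g f \<in> Hom C X Z"
    and comp_assoc: "\<lbrakk>W \<in> Obj C; X \<in> Obj C; Y \<in> Obj C; Z \<in> Obj C;
        f \<in> Hom C W X; g \<in> Hom C X Y; k \<in> Hom C Y Z\<rbrakk>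
      \<Longrightarrow> Comp C W X Z (Comp C X Y Z k g) f = Comp C W Y Z k (Comp C W X Y g f)"
    and comp_ident_left: "\<lbrakk>X \<in> Obj C; Y \<in> Obj C; f \<in> Hom C X Y\<rbrakk>
      \<Longrightarrow> Comp C X Y Y (Ident C Y) f = f"
    and comp_ident_right: "\<lbrakk>X \<in> Obj C; Y \<in> Obj C; f \<in> Hom C X Y\<rbrakk>
      \<Longrightarrow> Comp C X X Y f (Ident C X) = f"

record ('o, 'a) endofun =
  on_obj :: "'o \<Rightarrow> 'o"
  on_arr :: "'o \<Rightarrow> 'o \<Rightarrow> 'a \<Rightarrow> 'a"

locale endofunctor = category C
  for C :: "('o, 'a) cat" +
  fixes F :: "('o, 'a) endofun"
  assumes on_obj_closed: "X \<in> Obj C \<Longrightarrow> on_obj F X \<in> Obj C"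
    and on_arr_in_hom: "\<lbrakk>X \<in> Obj C; Y \<in> Obj C; f \<in> Hom C X Y\<rbrakk>
      \<Longrightarrow> on_arr F X Y f \<in> Hom C (on_obj F X) (on_obj F Y)"
    and on_arr_ident: "X \<in> Obj C \<Longrightarrow> on_arr F X X (Ident C X) = Ident C (on_obj F X)"
    and on_arr_comp: "\<lbrakk>X \<in> Obj C; Y \<in> Obj C; Z \<in> Obj C; f \<in> Hom C X Y; g \<in> Hom C Y Z\<rbrakk>
      \<Longrightarrow> on_arr F X Z (Comp C X Y Z g f) =
          Comp C (on_obj F X) (on_obj F Y) (on_obj F Z) (on_arr F Y Z g) (on_arr F X Y f)"

definition id_fun :: "('o, 'a) endofun" where
  "id_fun = \<lparr>on_obj = (\<lambda>X. X), on_arr = (\<lambda>X Y f. f)\<rparr>"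

definition comp_fun :: "('o, 'a) endofun \<Rightarrow> ('o, 'a) endofun \<Rightarrow> ('o, 'a) endofun" where
  "comp_fun G F = \<lparr>on_obj = (\<lambda>X. on_obj G (on_obj F X)),
     on_arr = (\<lambda>X Y f. on_arr G (on_obj F X) (on_obj F Y) (on_arr F X Y f))\<rparr>"

locale nat_transf = dom: endofunctor C F + cod: endofunctor C G
  for C :: "('o, 'a) cat" and F G :: "('o, 'a) endofun" +
  fixes n :: "'o \<Rightarrow> 'a"
  assumes component_in_hom: "X \<in> Obj C \<Longrightarrow> n X \<in> Hom C (on_obj F X) (on_obj G X)"
    and naturality: "\<lbrakk>X \<in> Obj C; Y \<in> Obj C; f \<in> Hom C X Y\<rbrakk>
      \<Longrightarrow> Comp C (on_obj F X) (on_obj F Y) (on_obj G Y) (n Y) (on_arr F X Y f) =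
          Comp C (on_obj F X) (on_obj G X) (on_obj G Y) (on_arr G X Y f) (n X)"

locale monad = endofunctor C S
  for C :: "('o, 'a) cat" and S :: "('o, 'a) endofun" +
  fixes m e :: "'o \<Rightarrow> 'a"
  assumes mult_natural: "nat_transf C (comp_fun S S) S m"
    and unit_natural: "nat_transf C id_fun S e"
    and mult_assoc: "X \<in> Obj C \<Longrightarrow>
      Comp C (on_obj S (on_obj S (on_obj S X))) (on_obj S (on_obj S X)) (on_obj S X)
        (m X) (m (on_obj S X)) =
      Comp C (on_obj S (on_obj S (on_obj S X))) (on_obj S (on_obj S X)) (on_obj S X)
        (m X) (on_arr S (on_obj S (on_obj S X)) (on_obj S X) (m X))"
    and mult_unit_left: "X \<in> Obj C \<Longrightarrow>
      Comp C (on_obj S X) (on_obj S (on_obj S X)) (on_obj S X) (m X) (e (on_obj S X)) =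
      Ident C (on_obj S X)"
    and mult_unit_right: "X \<in> Obj C \<Longrightarrow>
      Comp C (on_obj S X) (on_obj S (on_obj S X)) (on_obj S X)
        (m X) (on_arr S X (on_obj S X) (e X)) =
      Ident C (on_obj S X)"

locale monad_morphism =
  dom: monad C S m e + cod: monad C S' m' e' + nat_transf C S S' k
  for C :: "('o, 'a) cat"
    and S :: "('o, 'a) endofun" and m e :: "'o \<Rightarrow> 'a"
    and S' :: "('o, 'a) endofun" and m' e' :: "'o \<Rightarrow> 'a"
    and k :: "'o \<Rightarrow> 'a" +
  assumes preserves_unit: "X \<in> Obj C \<Longrightarrow>
      Comp C X (on_obj S X) (on_obj S' X) (k X) (e X) = e' X"
    and preserves_mult: "X \<in> Obj C \<Longrightarrow>
      Comp C (on_obj S (on_obj S X)) (on_obj S X) (on_obj S' X) (k X) (m X) =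
      Comp C (on_obj S (on_obj S X)) (on_obj S' (on_obj S' X)) (on_obj S' X) (m' X)
        (Comp C (on_obj S (on_obj S X)) (on_obj S' (on_obj S X)) (on_obj S' (on_obj S' X))
          (on_arr S' (on_obj S X) (on_obj S' X) (k X)) (k (on_obj S X)))"

locale free_monad =
  monad C S m e + nat_transf C F S \<nu>
  for C :: "('o, 'a) cat" and F S :: "('o, 'a) endofun" and m e \<nu> :: "'o \<Rightarrow> 'a" +
  assumes universal: "\<lbrakk>monad C S' m' e'; nat_transf C F S' n\<rbrakk> \<Longrightarrow>
      \<exists>k. monad_morphism C S m e S' m' e' k \<and>
        (\<forall>X\<in>Obj C. Comp C (on_obj F X) (on_obj S X) (on_obj S' X) (k X) (\<nu> X) = n X)"
    and universal_unique: "\<lbrakk>monad_morphism C S m e S' m' e' k; monad_morphism C S m e S' m' e' k';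
        \<forall>X\<in>Obj C. Comp C (on_obj F X) (on_obj S X) (on_obj S' X) (k X) (\<nu> X) =
                   Comp C (on_obj F X) (on_obj S X) (on_obj S' X) (k' X) (\<nu> X);
        X \<in> Obj C\<rbrakk> \<Longrightarrow> k X = k' X"


section \<open>Binary coproducts\<close>

record ('o, 'a) coprod =
  cop :: "'o \<Rightarrow> 'o \<Rightarrow> 'o"
  inj1 :: "'o \<Rightarrow> 'o \<Rightarrow> 'a"
  inj2 :: "'o \<Rightarrow> 'o \<Rightarrow> 'a"

definition is_cotuple ::
    "('o, 'a) cat \<Rightarrow> ('o, 'a) coprod \<Rightarrow> 'o \<Rightarrow> 'o \<Rightarrow> 'o \<Rightarrow> 'a \<Rightarrow> 'a \<Rightarrow> 'a \<Rightarrow> bool" where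
  "is_cotuple C P X Y Z f g k \<longleftrightarrow>
     k \<in> Hom C (cop P X Y) Z \<and>
     Comp C X (cop P X Y) Z k (inj1 P X Y) = f \<and>
     Comp C Y (cop P X Y) Z k (inj2 P X Y) = g"

locale binary_coproducts = category C
  for C :: "('o, 'a) cat" +
  fixes P :: "('o, 'a) coprod"
  assumes cop_closed: "\<lbrakk>X \<in> Obj C; Y \<in> Obj C\<rbrakk> \<Longrightarrow> cop P X Y \<in> Obj C"
    and inj1_in_hom: "\<lbrakk>X \<in> Obj C; Y \<in> Obj C\<rbrakk> \<Longrightarrow> inj1 P X Y \<in> Hom C X (cop P X Y)"
    and inj2_in_hom: "\<lbrakk>X \<in> Obj C; Y \<in> Obj C\<rbrakk> \<Longrightarrow> inj2 P X Y \<in> Hom C Y (cop P X Y)"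
    and cotuple_ex1: "\<lbrakk>X \<in> Obj C; Y \<in> Obj C; Z \<in> Obj C; f \<in> Hom C X Z; g \<in> Hom C Y Z\<rbrakk>
      \<Longrightarrow> \<exists>!k. is_cotuple C P X Y Z f g k"

definition cotuple ::
    "('o, 'a) cat \<Rightarrow> ('o, 'a) coprod \<Rightarrow> 'o \<Rightarrow> 'o \<Rightarrow> 'o \<Rightarrow> 'a \<Rightarrow> 'a \<Rightarrow> 'a" where
  "cotuple C P X Y Z f g = (THE k. is_cotuple C P X Y Z f g k)"

text \<open>\<open>f + g : X + Y \<rightarrow> X' + Y'\<close> for \<open>f : X \<rightarrow> X'\<close> and \<open>g : Y \<rightarrow> Y'\<close>.\<close>
definition cop_arr ::
    "('o, 'a) cat \<Rightarrow> ('o, 'a) coprod \<Rightarrow> 'o \<Rightarrow> 'o \<Rightarrow> 'o \<Rightarrow> 'o \<Rightarrow> 'a \<Rightarrow> 'a \<Rightarrow> 'a" where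
  "cop_arr C P X Y X' Y' f g =
     cotuple C P X Y (cop P X' Y')
       (Comp C X X' (cop P X' Y') (inj1 P X' Y') f)
       (Comp C Y Y' (cop P X' Y') (inj2 P X' Y') g)"

definition plus_id ::
    "('o, 'a) cat \<Rightarrow> ('o, 'a) coprod \<Rightarrow> ('o, 'a) endofun \<Rightarrow> ('o, 'a) endofun" where
  "plus_id C P F = \<lparr>on_obj = (\<lambda>X. cop P (on_obj F X) X),
     on_arr = (\<lambda>X Y f. cop_arr C P (on_obj F X) X (on_obj F Y) Y (on_arr F X Y f) f)\<rparr>"


section \<open>Free algebras\<close>

record ('o, 'a) free_algs =
  free_obj :: "'o \<Rightarrow> 'o"
  free_str :: "'o \<Rightarrow> 'a"
  free_unit :: "'o \<Rightarrow> 'a"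

text \<open>\<open>k\<close> is an algebra homomorphism from the free algebra over \<open>X\<close> to \<open>a : F A \<rightarrow> A\<close>,
  and it extends \<open>f : X \<rightarrow> A\<close>.\<close>
definition is_free_ext ::
    "('o, 'a) cat \<Rightarrow> ('o, 'a) endofun \<Rightarrow> ('o, 'a) free_algs \<Rightarrow> 'o \<Rightarrow> 'o \<Rightarrow> 'a \<Rightarrow> 'a \<Rightarrow> 'a \<Rightarrow> bool"
where
  "is_free_ext C F A\<^sub>F X A a f k \<longleftrightarrow>
     k \<in> Hom C (free_obj A\<^sub>F X) A \<and>
     Comp C (on_obj F (free_obj A\<^sub>F X)) (free_obj A\<^sub>F X) A k (free_str A\<^sub>F X) =
       Comp C (on_obj F (free_obj A\<^sub>F X)) (on_obj F A) A a (on_arr F (free_obj A\<^sub>F X) A k) \<and>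
     Comp C X (free_obj A\<^sub>F X) A k (free_unit A\<^sub>F X) = f"

locale free_algebras = endofunctor C F
  for C :: "('o, 'a) cat" and F :: "('o, 'a) endofun" +
  fixes A\<^sub>F :: "('o, 'a) free_algs"
  assumes free_obj_closed: "X \<in> Obj C \<Longrightarrow> free_obj A\<^sub>F X \<in> Obj C"
    and free_str_in_hom: "X \<in> Obj C \<Longrightarrow>
      free_str A\<^sub>F X \<in> Hom C (on_obj F (free_obj A\<^sub>F X)) (free_obj A\<^sub>F X)"
    and free_unit_in_hom: "X \<in> Obj C \<Longrightarrow> free_unit A\<^sub>F X \<in> Hom C X (free_obj A\<^sub>F X)"
    and free_ext_ex1: "\<lbrakk>X \<in> Obj C; A \<in> Obj C; a \<in> Hom C (on_obj F A) A; f \<in> Hom C X A\<rbrakk>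
      \<Longrightarrow> \<exists>!k. is_free_ext C F A\<^sub>F X A a f k"

text \<open>The functor \<open>F\<^sup>*\<close> underlying the free monad: \<open>F\<^sup>* f\<close> is the homomorphism of
  free algebras that extends the composite of \<open>f\<close> with the unit.\<close>
definition free_fun ::
    "('o, 'a) cat \<Rightarrow> ('o, 'a) endofun \<Rightarrow> ('o, 'a) free_algs \<Rightarrow> ('o, 'a) endofun" where
  "free_fun C F A\<^sub>F = \<lparr>on_obj = free_obj A\<^sub>F,
     on_arr = (\<lambda>X Y f. THE k. is_free_ext C F A\<^sub>F X (free_obj A\<^sub>F Y) (free_str A\<^sub>F Y)
       (Comp C X Y (free_obj A\<^sub>F Y) (free_unit A\<^sub>F Y) f) k)\<rparr>"


section \<open>Kleisli categories\<close>

definition kleisli ::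
    "('o, 'a) cat \<Rightarrow> ('o, 'a) endofun \<Rightarrow> ('o \<Rightarrow> 'a) \<Rightarrow> ('o \<Rightarrow> 'a) \<Rightarrow> ('o, 'a) cat" where
  "kleisli C T \<mu> \<eta> = \<lparr>
     Obj = Obj C,
     Hom = (\<lambda>X Y. Hom C X (on_obj T Y)),
     Comp = (\<lambda>X Y Z g f.
       Comp C X (on_obj T (on_obj T Z)) (on_obj T Z) (\<mu> Z)
         (Comp C X (on_obj T Y) (on_obj T (on_obj T Z)) (on_arr T Y (on_obj T Z) g) f)),
     Ident = \<eta>\<rparr>"

definition sharp ::
    "('o, 'a) cat \<Rightarrow> ('o, 'a) endofun \<Rightarrow> ('o \<Rightarrow> 'a) \<Rightarrow> 'o \<Rightarrow> 'o \<Rightarrow> 'a \<Rightarrow> 'a" where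
  "sharp C T \<eta> X Y f = Comp C X Y (on_obj T Y) (\<eta> Y) f"

definition kleisli_coprod ::
    "('o, 'a) cat \<Rightarrow> ('o, 'a) endofun \<Rightarrow> ('o \<Rightarrow> 'a) \<Rightarrow> ('o, 'a) coprod \<Rightarrow> ('o, 'a) coprod" where
  "kleisli_coprod C T \<eta> P = \<lparr>
     cop = cop P,
     inj1 = (\<lambda>X Y. sharp C T \<eta> X (cop P X Y) (inj1 P X Y)),
     inj2 = (\<lambda>X Y. sharp C T \<eta> Y (cop P X Y) (inj2 P X Y))\<rparr>"

locale kleisli_lifting =
  monad C T \<mu> \<eta> + base: endofunctor C S + lifted: endofunctor "kleisli C T \<mu> \<eta>" Sb
  for C :: "('o, 'a) cat" and T :: "('o, 'a) endofun" and \<mu> \<eta> :: "'o \<Rightarrow> 'a"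
    and S Sb :: "('o, 'a) endofun" +
  assumes lift_obj: "X \<in> Obj C \<Longrightarrow> on_obj Sb X = on_obj S X"
    and lift_arr: "\<lbrakk>X \<in> Obj C; Y \<in> Obj C; f \<in> Hom C X Y\<rbrakk> \<Longrightarrow>
      on_arr Sb X Y (sharp C T \<eta> X Y f) =
      sharp C T \<eta> (on_obj S X) (on_obj S Y) (on_arr S X Y f)"


section \<open>Order enrichment and saturation\<close>

locale order_enriched = category K
  for K :: "('o, 'a) cat" +
  fixes le :: "'o \<Rightarrow> 'o \<Rightarrow> 'a \<Rightarrow> 'a \<Rightarrow> bool"
  assumes le_refl: "\<lbrakk>X \<in> Obj K; Y \<in> Obj K; f \<in> Hom K X Y\<rbrakk> \<Longrightarrow> le X Y f f"
    and le_trans: "\<lbrakk>X \<in> Obj K; Y \<in> Obj K; f \<in> Hom K X Y; g \<in> Hom K X Y; k \<in> Hom K X Y;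
        le X Y f g; le X Y g k\<rbrakk> \<Longrightarrow> le X Y f k"
    and le_antisym: "\<lbrakk>X \<in> Obj K; Y \<in> Obj K; f \<in> Hom K X Y; g \<in> Hom K X Y;
        le X Y f g; le X Y g f\<rbrakk> \<Longrightarrow> f = g"
    and comp_mono: "\<lbrakk>X \<in> Obj K; Y \<in> Obj K; Z \<in> Obj K;
        f \<in> Hom K X Y; f' \<in> Hom K X Y; g \<in> Hom K Y Z; g' \<in> Hom K Y Z;
        le X Y f f'; le Y Z g g'\<rbrakk>
      \<Longrightarrow> le X Z (Comp K X Y Z g f) (Comp K X Y Z g' f')"

text \<open>The saturation \<open>star X \<alpha>\<close> of \<open>\<alpha>\<close> is determined by the first five assumptions.
  The last two are the instances \<open>\<le>\<close> and \<open>\<ge>\<close> of one condition.\<close>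
locale order_saturation_monad =
  monad C T \<mu> \<eta> + kl: order_enriched "kleisli C T \<mu> \<eta>" le
  for C :: "('o, 'a) cat" and T :: "('o, 'a) endofun" and \<mu> \<eta> :: "'o \<Rightarrow> 'a"
    and le :: "'o \<Rightarrow> 'o \<Rightarrow> 'a \<Rightarrow> 'a \<Rightarrow> bool" +
  fixes star :: "'o \<Rightarrow> 'a \<Rightarrow> 'a"
  assumes star_in_hom: "\<lbrakk>X \<in> Obj C; \<alpha> \<in> Hom (kleisli C T \<mu> \<eta>) X X\<rbrakk>
      \<Longrightarrow> star X \<alpha> \<in> Hom (kleisli C T \<mu> \<eta>) X X"
    and ident_le_star: "\<lbrakk>X \<in> Obj C; \<alpha> \<in> Hom (kleisli C T \<mu> \<eta>) X X\<rbrakk>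
      \<Longrightarrow> le X X (Ident (kleisli C T \<mu> \<eta>) X) (star X \<alpha>)"
    and le_star: "\<lbrakk>X \<in> Obj C; \<alpha> \<in> Hom (kleisli C T \<mu> \<eta>) X X\<rbrakk> \<Longrightarrow> le X X \<alpha> (star X \<alpha>)"
    and star_star_le: "\<lbrakk>X \<in> Obj C; \<alpha> \<in> Hom (kleisli C T \<mu> \<eta>) X X\<rbrakk>
      \<Longrightarrow> le X X (Comp (kleisli C T \<mu> \<eta>) X X X (star X \<alpha>) (star X \<alpha>)) (star X \<alpha>)"
    and star_least: "\<lbrakk>X \<in> Obj C; \<alpha> \<in> Hom (kleisli C T \<mu> \<eta>) X X; \<beta> \<in> Hom (kleisli C T \<mu> \<eta>) X X;
        le X X (Ident (kleisli C T \<mu> \<eta>) X) \<beta>; le X X \<alpha> \<beta>;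
        le X X (Comp (kleisli C T \<mu> \<eta>) X X X \<beta> \<beta>) \<beta>\<rbrakk>
      \<Longrightarrow> le X X (star X \<alpha>) \<beta>"
    and star_sharp_le: "\<lbrakk>X \<in> Obj C; Y \<in> Obj C; f \<in> Hom C X Y;
        \<alpha> \<in> Hom (kleisli C T \<mu> \<eta>) X X; \<beta> \<in> Hom (kleisli C T \<mu> \<eta>) Y Y;
        le X Y (Comp (kleisli C T \<mu> \<eta>) X X Y (sharp C T \<eta> X Y f) \<alpha>)
               (Comp (kleisli C T \<mu> \<eta>) X Y Y \<beta> (sharp C T \<eta> X Y f))\<rbrakk>
      \<Longrightarrow> le X Y (Comp (kleisli C T \<mu> \<eta>) X X Y (sharp C T \<eta> X Y f) (star X \<alpha>))
                 (Comp (kleisli C T \<mu> \<eta>) X Y Y (star Y \<beta>) (sharp C T \<eta> X Y f))"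
    and star_sharp_ge: "\<lbrakk>X \<in> Obj C; Y \<in> Obj C; f \<in> Hom C X Y;
        \<alpha> \<in> Hom (kleisli C T \<mu> \<eta>) X X; \<beta> \<in> Hom (kleisli C T \<mu> \<eta>) Y Y;
        le X Y (Comp (kleisli C T \<mu> \<eta>) X Y Y \<beta> (sharp C T \<eta> X Y f))
               (Comp (kleisli C T \<mu> \<eta>) X X Y (sharp C T \<eta> X Y f) \<alpha>)\<rbrakk>
      \<Longrightarrow> le X Y (Comp (kleisli C T \<mu> \<eta>) X Y Y (star Y \<beta>) (sharp C T \<eta> X Y f))
                 (Comp (kleisli C T \<mu> \<eta>) X X Y (sharp C T \<eta> X Y f) (star X \<alpha>))"

locale zero_morphisms = category K
  for K :: "('o, 'a) cat" +
  fixes zero :: "'o \<Rightarrow> 'o \<Rightarrow> 'a"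
  assumes zero_in_hom: "\<lbrakk>X \<in> Obj K; Y \<in> Obj K\<rbrakk> \<Longrightarrow> zero X Y \<in> Hom K X Y"
    and comp_zero_right: "\<lbrakk>X \<in> Obj K; Y \<in> Obj K; Z \<in> Obj K; f \<in> Hom K Y Z\<rbrakk>
      \<Longrightarrow> Comp K X Y Z f (zero X Y) = zero X Z"
    and comp_zero_left: "\<lbrakk>X \<in> Obj K; Y \<in> Obj K; Z \<in> Obj K; g \<in> Hom K X Y\<rbrakk>
      \<Longrightarrow> Comp K X Y Z (zero Y Z) g = zero X Z"

definition locally_monotonic ::
    "('o, 'a) cat \<Rightarrow> ('o \<Rightarrow> 'o \<Rightarrow> 'a \<Rightarrow> 'a \<Rightarrow> bool) \<Rightarrow> ('o, 'a) endofun \<Rightarrow> bool" where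
  "locally_monotonic K le S \<longleftrightarrow>
     (\<forall>X\<in>Obj K. \<forall>Y\<in>Obj K. \<forall>f\<in>Hom K X Y. \<forall>g\<in>Hom K X Y.
        le X Y f g \<longrightarrow> le (on_obj S X) (on_obj S Y) (on_arr S X Y f) (on_arr S X Y g))"

text \<open>The endomorphism \<open>m\<^sub>X \<cdot> S \<alpha>\<close> of \<open>S X\<close> for \<open>\<alpha> : X \<rightarrow> S X\<close>.\<close>
definition kleisli_ext ::
    "('o, 'a) cat \<Rightarrow> ('o, 'a) endofun \<Rightarrow> ('o \<Rightarrow> 'a) \<Rightarrow> 'o \<Rightarrow> 'a \<Rightarrow> 'a" where
  "kleisli_ext K S m X \<alpha> =
     Comp K (on_obj S X) (on_obj S (on_obj S X)) (on_obj S X) (m X) (on_arr S X (on_obj S X) \<alpha>)"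

text \<open>The operator \<open>\<alpha> \<mapsto> (m\<^sub>X \<cdot> S \<alpha>)\<^sup>* \<cdot> e\<^sub>X\<close> on morphisms \<open>X \<rightarrow> S X\<close>.\<close>
definition saturate ::
    "('o, 'a) cat \<Rightarrow> ('o \<Rightarrow> 'a \<Rightarrow> 'a) \<Rightarrow> ('o, 'a) endofun \<Rightarrow> ('o \<Rightarrow> 'a) \<Rightarrow> ('o \<Rightarrow> 'a)
      \<Rightarrow> 'o \<Rightarrow> 'a \<Rightarrow> 'a" where
  "saturate K star S m e X \<alpha> =
     Comp K X (on_obj S X) (on_obj S X) (star (on_obj S X) (kleisli_ext K S m X \<alpha>)) (e X)"

definition saturation_compatible ::
    "('o, 'a) cat \<Rightarrow> ('o \<Rightarrow> 'a \<Rightarrow> 'a) \<Rightarrow> ('o, 'a) endofun \<Rightarrow> ('o \<Rightarrow> 'a) \<Rightarrow> ('o \<Rightarrow> 'a) \<Rightarrow> bool" where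
  "saturation_compatible K star S m e \<longleftrightarrow>
     (\<forall>X\<in>Obj K. \<forall>\<alpha>\<in>Hom K X (on_obj S X).
        kleisli_ext K S m X (saturate K star S m e X \<alpha>) =
        star (on_obj S X) (kleisli_ext K S m X \<alpha>))"


section \<open>The monad \<open>F + Id\<close> in the presence of zero morphisms\<close>

definition tau_unit ::
    "('o, 'a) coprod \<Rightarrow> ('o, 'a) endofun \<Rightarrow> 'o \<Rightarrow> 'a" where
  "tau_unit P F X = inj2 P (on_obj F X) X"

text \<open>\<open>[\<iota>\<^sup>1, id] \<cdot> (F [0, id] + id) : F (F X + X) + (F X + X) \<rightarrow> F X + X\<close>\<close>
definition tau_mult ::
    "('o, 'a) cat \<Rightarrow> ('o, 'a) coprod \<Rightarrow> ('o \<Rightarrow> 'o \<Rightarrow> 'a) \<Rightarrow> ('o, 'a) endofun \<Rightarrow> 'o \<Rightarrow> 'a" where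
  "tau_mult K P zero F X =
     (let FX = on_obj F X; B = cop P FX X; FB = on_obj F B in
      Comp K (cop P FB B) (cop P FX B) B
        (cotuple K P FX B B (inj1 P FX X) (Ident K B))
        (cop_arr K P FB B FX B
          (on_arr F B X (cotuple K P FX X X (zero FX X) (Ident K X)))
          (Ident K B)))"


section \<open>Kernel bisimulations\<close>

definition coalgebra :: "('o, 'a) cat \<Rightarrow> ('o, 'a) endofun \<Rightarrow> 'o \<Rightarrow> 'a \<Rightarrow> bool" where
  "coalgebra C G X \<alpha> \<longleftrightarrow> X \<in> Obj C \<and> \<alpha> \<in> Hom C X (on_obj G X)"

definition coalgebra_hom ::
    "('o, 'a) cat \<Rightarrow> ('o, 'a) endofun \<Rightarrow> 'o \<Rightarrow> 'a \<Rightarrow> 'o \<Rightarrow> 'a \<Rightarrow> 'a \<Rightarrow> bool" where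
  "coalgebra_hom C G X \<alpha> Y \<beta> f \<longleftrightarrow>
     f \<in> Hom C X Y \<and>
     Comp C X (on_obj G X) (on_obj G Y) (on_arr G X Y f) \<alpha> = Comp C X Y (on_obj G Y) \<beta> f"

definition jointly_monic_span ::
    "('o, 'a) cat \<Rightarrow> 'o \<Rightarrow> 'o \<Rightarrow> 'o \<Rightarrow> 'a \<Rightarrow> 'a \<Rightarrow> bool" where
  "jointly_monic_span C X Y R p\<^sub>1 p\<^sub>2 \<longleftrightarrow>
     R \<in> Obj C \<and> p\<^sub>1 \<in> Hom C R X \<and> p\<^sub>2 \<in> Hom C R Y \<and>
     (\<forall>Q\<in>Obj C. \<forall>u\<in>Hom C Q R. \<forall>v\<in>Hom C Q R.
        Comp C Q R X p\<^sub>1 u = Comp C Q R X p\<^sub>1 v \<and> Comp C Q R Y p\<^sub>2 u = Comp C Q R Y p\<^sub>2 v \<longrightarrow> u = v)"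

definition is_pullback ::
    "('o, 'a) cat \<Rightarrow> 'o \<Rightarrow> 'o \<Rightarrow> 'o \<Rightarrow> 'a \<Rightarrow> 'a \<Rightarrow> 'o \<Rightarrow> 'a \<Rightarrow> 'a \<Rightarrow> bool" where
  "is_pullback C X Y Z f g R p\<^sub>1 p\<^sub>2 \<longleftrightarrow>
     R \<in> Obj C \<and> p\<^sub>1 \<in> Hom C R X \<and> p\<^sub>2 \<in> Hom C R Y \<and>
     Comp C R X Z f p\<^sub>1 = Comp C R Y Z g p\<^sub>2 \<and>
     (\<forall>Q\<in>Obj C. \<forall>q\<^sub>1\<in>Hom C Q X. \<forall>q\<^sub>2\<in>Hom C Q Y.
        Comp C Q X Z f q\<^sub>1 = Comp C Q Y Z g q\<^sub>2 \<longrightarrow>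
        (\<exists>!u. u \<in> Hom C Q R \<and> Comp C Q R X p\<^sub>1 u = q\<^sub>1 \<and> Comp C Q R Y p\<^sub>2 u = q\<^sub>2))"

definition bisimulation ::
    "('o, 'a) cat \<Rightarrow> ('o, 'a) endofun \<Rightarrow> 'o \<Rightarrow> 'a \<Rightarrow> 'o \<Rightarrow> 'a \<Rightarrow> 'o \<Rightarrow> 'a \<Rightarrow> 'a \<Rightarrow> bool" where
  "bisimulation C G X \<alpha> Y \<beta> R p\<^sub>1 p\<^sub>2 \<longleftrightarrow>
     coalgebra C G X \<alpha> \<and> coalgebra C G Y \<beta> \<and> jointly_monic_span C X Y R p\<^sub>1 p\<^sub>2 \<and>
     (\<exists>Z \<gamma> f g. coalgebra C G Z \<gamma> \<and> coalgebra_hom C G X \<alpha> Z \<gamma> f \<and> coalgebra_hom C G Y \<beta> Z \<gamma> g \<and>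
        is_pullback C X Y Z f g R p\<^sub>1 p\<^sub>2)"

end

theory Submission
  imports Defs
begin

text \<open>
  Since \<open>h \<cdot> [\<nu>, e] = [\<iota>\<^sup>1, \<iota>\<^sup>2] = id\<close>, the monad morphism \<open>h\<close> maps \<open>\<alpha>'\<close> back to \<open>\<alpha>\<close> and therefore
  intertwines the endomorphisms \<open>m \<cdot> F\<^sup>* \<alpha>'\<close> and \<open>m' \<cdot> F\<^sub>\<tau> \<alpha>\<close>. By the hypothesis on saturations it
  also intertwines their saturations, and precomposing with the units shows that the saturation of
  \<open>\<alpha>\<close> is the composite of \<open>h\<close> with the saturation of \<open>\<alpha>'\<close>. Finally, composing with the
  components of \<open>h\<close> turns \<open>TF\<^sup>*\<close>-coalgebras into \<open>TF\<^sub>\<tau>\<close>-coalgebras and keeps all homomorphisms,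
  so the cospan exhibiting a bisimulation can be reused.
\<close>

section \<open>Laws of cotupling\<close>

context binary_coproducts
begin

lemma is_cotuple_cotuple:
  assumes "X \<in> Obj C" "Y \<in> Obj C" "Z \<in> Obj C" "f \<in> Hom C X Z" "g \<in> Hom C Y Z"
  shows "is_cotuple C P X Y Z f g (cotuple C P X Y Z f g)"
  unfolding cotuple_def by (rule theI') (rule cotuple_ex1[OF assms])

lemma cotuple_unique:
  assumes "X \<in> Obj C" "Y \<in> Obj C" "Z \<in> Obj C" "f \<in> Hom C X Z" "g \<in> Hom C Y Z"
    and "is_cotuple C P X Y Z f g k"
  shows "cotuple C P X Y Z f g = k"
  unfolding cotuple_def by (rule the1_equality) (rule cotuple_ex1[OF assms(1-5)], rule assms(6))

lemma cotuple_in_hom: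
  assumes "X \<in> Obj C" "Y \<in> Obj C" "Z \<in> Obj C" "f \<in> Hom C X Z" "g \<in> Hom C Y Z"
  shows "cotuple C P X Y Z f g \<in> Hom C (cop P X Y) Z"
  using is_cotuple_cotuple[OF assms] by (simp add: is_cotuple_def)

text \<open>By associativity the composite satisfies both defining equations of the cotuple on the
  right, so uniqueness identifies the two.\<close>

lemma comp_cotuple:
  assumes "X \<in> Obj C" "Y \<in> Obj C" "Z \<in> Obj C" "W \<in> Obj C"
    and "f \<in> Hom C X Z" "g \<in> Hom C Y Z" "k \<in> Hom C Z W"
  shows "Comp C (cop P X Y) Z W k (cotuple C P X Y Z f g) =
    cotuple C P X Y W (Comp C X Z W k f) (Comp C Y Z W k g)"
proof (rule cotuple_unique[symmetric])
  show "is_cotuple C P X Y W (Comp C X Z W k f) (Comp C Y Z W k g)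
      (Comp C (cop P X Y) Z W k (cotuple C P X Y Z f g))"
    using is_cotuple_cotuple[of X Y Z f g] assms
    by (simp add: is_cotuple_def comp_in_hom comp_assoc cop_closed inj1_in_hom inj2_in_hom)
qed (use assms in \<open>auto intro: comp_in_hom\<close>)

lemma cotuple_injections:
  assumes "X \<in> Obj C" "Y \<in> Obj C"
  shows "cotuple C P X Y (cop P X Y) (inj1 P X Y) (inj2 P X Y) = Ident C (cop P X Y)"
  by (rule cotuple_unique)
    (use assms in \<open>auto simp: is_cotuple_def cop_closed inj1_in_hom inj2_in_hom ident_in_hom
      comp_ident_left\<close>)

end

section \<open>Kleisli composition with pure morphisms\<close>

context monad
begin

abbreviation "kl \<equiv> kleisli C S m e"

lemma unit_in_hom: "X \<in> Obj C \<Longrightarrow> e X \<in> Hom C X (on_obj S X)"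
  using nat_transf.component_in_hom[OF unit_natural] by (simp add: id_fun_def)

lemma mult_in_hom: "X \<in> Obj C \<Longrightarrow> m X \<in> Hom C (on_obj S (on_obj S X)) (on_obj S X)"
  using nat_transf.component_in_hom[OF mult_natural] by (simp add: comp_fun_def)

lemma unit_nat:
  assumes "X \<in> Obj C" "Y \<in> Obj C" "f \<in> Hom C X Y"
  shows "Comp C X Y (on_obj S Y) (e Y) f =
    Comp C X (on_obj S X) (on_obj S Y) (on_arr S X Y f) (e X)"
  using nat_transf.naturality[OF unit_natural assms] by (simp add: id_fun_def)

lemma sharp_in_hom:
  "\<lbrakk>X \<in> Obj C; Y \<in> Obj C; f \<in> Hom C X Y\<rbrakk> \<Longrightarrow> sharp C S e X Y f \<in> Hom C X (on_obj S Y)"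
  unfolding sharp_def by (auto intro: comp_in_hom unit_in_hom on_obj_closed)

text \<open>Naturality of \<open>e\<close> turns S g \<cdot> e into e \<cdot> g, and
  \<open>mult_unit_left\<close> then cancels \<open>m\<close> against \<open>e\<close>.\<close>

lemma kleisli_comp_sharp_right:
  assumes [simp]: "X \<in> Obj C" "Y \<in> Obj C" "Z \<in> Obj C"
    and f: "f \<in> Hom C X Y" and g: "g \<in> Hom C Y (on_obj S Z)"
  shows "Comp kl X Y Z g (sharp C S e X Y f) = Comp C X Y (on_obj S Z) g f"
proof -
  let ?SZ = "on_obj S Z" and ?SY = "on_obj S Y"
  have [simp]: "?SZ \<in> Obj C" "?SY \<in> Obj C" "on_obj S ?SZ \<in> Obj C"
    by (simp_all add: on_obj_closed)
  have Sg: "on_arr S Y ?SZ g \<in> Hom C ?SY (on_obj S ?SZ)"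
    using g by (simp add: on_arr_in_hom)
  have "Comp C X ?SY (on_obj S ?SZ) (on_arr S Y ?SZ g) (Comp C X Y ?SY (e Y) f) =
      Comp C X Y (on_obj S ?SZ) (Comp C Y ?SY (on_obj S ?SZ) (on_arr S Y ?SZ g) (e Y)) f"
    using f Sg by (simp add: comp_assoc unit_in_hom)
  also have "\<dots> = Comp C X Y (on_obj S ?SZ) (Comp C Y ?SZ (on_obj S ?SZ) (e ?SZ) g) f"
    using g by (simp add: unit_nat)
  also have "\<dots> = Comp C X ?SZ (on_obj S ?SZ) (e ?SZ) (Comp C X Y ?SZ g f)"
    using f g by (simp add: comp_assoc unit_in_hom)
  finally have "Comp kl X Y Z g (sharp C S e X Y f) =
      Comp C X (on_obj S ?SZ) ?SZ (m Z) (Comp C X ?SZ (on_obj S ?SZ) (e ?SZ) (Comp C X Y ?SZ g f))"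
    by (simp add: kleisli_def sharp_def)
  also have "\<dots> = Comp C X ?SZ ?SZ (Comp C ?SZ (on_obj S ?SZ) ?SZ (m Z) (e ?SZ)) (Comp C X Y ?SZ g f)"
    by (rule comp_assoc[symmetric])
      (use f g in \<open>auto intro: comp_in_hom[of X Y ?SZ] unit_in_hom mult_in_hom\<close>)
  also have "\<dots> = Comp C X Y ?SZ g f"
    using comp_in_hom[OF _ _ _ f g] by (simp add: mult_unit_left comp_ident_left)
  finally show ?thesis .
qed

text \<open>Functoriality splits S (e \<cdot> f) into S e \<cdot> S f, and
  \<open>mult_unit_right\<close> cancels m \<cdot> S e. Together with
  \<open>kleisli_comp_sharp_right\<close> this translates both sides of a coalgebra homomorphism
  equation into Kleisli composites.\<close>

lemma kleisli_comp_sharp_left: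
  assumes [simp]: "X \<in> Obj C" "Y \<in> Obj C" "Z \<in> Obj C"
    and f: "f \<in> Hom C Y Z" and g: "g \<in> Hom C X (on_obj S Y)"
  shows "Comp kl X Y Z (sharp C S e Y Z f) g =
    Comp C X (on_obj S Y) (on_obj S Z) (on_arr S Y Z f) g"
proof -
  let ?SZ = "on_obj S Z" and ?SY = "on_obj S Y"
  have [simp]: "?SZ \<in> Obj C" "?SY \<in> Obj C" "on_obj S ?SZ \<in> Obj C"
    by (simp_all add: on_obj_closed)
  have Sf: "on_arr S Y Z f \<in> Hom C ?SY ?SZ" and Se: "on_arr S Z ?SZ (e Z) \<in> Hom C ?SZ (on_obj S ?SZ)"
    using f by (simp_all add: on_arr_in_hom unit_in_hom)
  have Sfg: "Comp C X ?SY ?SZ (on_arr S Y Z f) g \<in> Hom C X ?SZ"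
    using Sf g by (auto intro: comp_in_hom[of X ?SY ?SZ])
  have "Comp kl X Y Z (sharp C S e Y Z f) g = Comp C X (on_obj S ?SZ) ?SZ (m Z)
      (Comp C X ?SY (on_obj S ?SZ)
        (Comp C ?SY ?SZ (on_obj S ?SZ) (on_arr S Z ?SZ (e Z)) (on_arr S Y Z f)) g)"
    using f by (simp add: kleisli_def sharp_def on_arr_comp unit_in_hom)
  also have "\<dots> = Comp C X (on_obj S ?SZ) ?SZ (m Z)
      (Comp C X ?SZ (on_obj S ?SZ) (on_arr S Z ?SZ (e Z)) (Comp C X ?SY ?SZ (on_arr S Y Z f) g))"
    using Sf Se g by (simp add: comp_assoc)
  also have "\<dots> = Comp C X ?SZ ?SZ (Comp C ?SZ (on_obj S ?SZ) ?SZ (m Z) (on_arr S Z ?SZ (e Z)))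
      (Comp C X ?SY ?SZ (on_arr S Y Z f) g)"
    by (rule comp_assoc[symmetric]) (use Sfg Se in \<open>auto intro: mult_in_hom\<close>)
  also have "\<dots> = Comp C X ?SY ?SZ (on_arr S Y Z f) g"
    using Sfg by (simp add: mult_unit_right comp_ident_left)
  finally show ?thesis .
qed

end

section \<open>Coproducts of the Kleisli category and the lifting of F + Id\<close>

locale monad_with_coproducts = monad C T \<mu> \<eta> + binary_coproducts C P
  for C :: "('o, 'a) cat" and T :: "('o, 'a) endofun" and \<mu> \<eta> :: "'o \<Rightarrow> 'a"
    and P :: "('o, 'a) coprod"
begin

abbreviation "klP \<equiv> kleisli_coprod C T \<eta> P"

text \<open>The injections of \<open>klP\<close> are pure, so Kleisli precomposition with them is
  precomposition in \<open>C\<close> with the injections of \<open>P\<close>, by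
  \<open>kleisli_comp_sharp_right\<close>.\<close>

lemma is_cotuple_kleisli:
  assumes "X \<in> Obj C" "Y \<in> Obj C" "Z \<in> Obj C"
  shows "is_cotuple kl klP X Y Z f g k \<longleftrightarrow> is_cotuple C P X Y (on_obj T Z) f g k"
proof -
  have "Hom kl X' Y' = Hom C X' (on_obj T Y')" for X' Y'
    by (simp add: kleisli_def)
  then show ?thesis
    using assms
    by (auto simp: is_cotuple_def kleisli_coprod_def kleisli_comp_sharp_right cop_closed
        inj1_in_hom inj2_in_hom)
qed

lemma cotuple_kleisli:
  assumes "X \<in> Obj C" "Y \<in> Obj C" "Z \<in> Obj C"
  shows "cotuple kl klP X Y Z f g = cotuple C P X Y (on_obj T Z) f g"
  by (simp add: cotuple_def is_cotuple_kleisli[OF assms])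

text \<open>The category axioms for \<open>kl\<close> are a premise here; they are part of the order
  enrichment in \<open>order_saturation_monad\<close>.\<close>

lemma binary_coproducts_kleisli:
  assumes "category kl"
  shows "binary_coproducts kl klP"
proof -
  interpret kl: category kl by fact
  have [simp]: "Obj kl = Obj C" "Hom kl X Y = Hom C X (on_obj T Y)" "cop klP = cop P" for X Y
    by (simp_all add: kleisli_def kleisli_coprod_def)
  show ?thesis
  proof
    fix X Y Z f g assume "X \<in> Obj kl" "Y \<in> Obj kl" "Z \<in> Obj kl" "f \<in> Hom kl X Z" "g \<in> Hom kl Y Z"
    then show "\<exists>!k. is_cotuple kl klP X Y Z f g k"
      by (simp add: is_cotuple_kleisli cotuple_ex1 on_obj_closed)
  qed (simp_all add: cop_closed, simp_all add: kleisli_coprod_def sharp_in_hom cop_closed inj1_in_hom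
      inj2_in_hom)
qed

lemma sharp_cotuple:
  assumes "X \<in> Obj C" "Y \<in> Obj C" "Z \<in> Obj C" "f \<in> Hom C X Z" "g \<in> Hom C Y Z"
  shows "sharp C T \<eta> (cop P X Y) Z (cotuple C P X Y Z f g) =
    cotuple kl klP X Y Z (sharp C T \<eta> X Z f) (sharp C T \<eta> Y Z g)"
  using assms by (simp add: sharp_def cotuple_kleisli comp_cotuple on_obj_closed unit_in_hom)

text \<open>The embedding \<open>sharp\<close> of \<open>C\<close> into the Kleisli category
  preserves composites and cotuples, and the injections of \<open>klP\<close> are the images of
  those of \<open>P\<close>.\<close>

lemma sharp_cop_arr:
  assumes "X \<in> Obj C" "Y \<in> Obj C" "X' \<in> Obj C" "Y' \<in> Obj C" "f \<in> Hom C X X'" "g \<in> Hom C Y Y'"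
  shows "sharp C T \<eta> (cop P X Y) (cop P X' Y') (cop_arr C P X Y X' Y' f g) =
    cop_arr kl klP X Y X' Y' (sharp C T \<eta> X X' f) (sharp C T \<eta> Y Y' g)"
proof -
  have [simp]: "cop P X' Y' \<in> Obj C" and i: "inj1 P X' Y' \<in> Hom C X' (cop P X' Y')"
    "inj2 P X' Y' \<in> Hom C Y' (cop P X' Y')"
    using assms by (simp_all add: cop_closed inj1_in_hom inj2_in_hom)
  have "Comp kl A B D (sharp C T \<eta> B D k) (sharp C T \<eta> A B l) = sharp C T \<eta> A D (Comp C A B D k l)"
    if "A \<in> Obj C" "B \<in> Obj C" "D \<in> Obj C" "k \<in> Hom C B D" "l \<in> Hom C A B" for A B D k l
    using that by (simp add: kleisli_comp_sharp_right sharp_in_hom)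
      (simp add: sharp_def comp_assoc unit_in_hom on_obj_closed)
  then show ?thesis
    unfolding cop_arr_def using assms i
    by (simp add: sharp_cotuple comp_in_hom) (simp add: kleisli_coprod_def)
qed

text \<open>The theorem assumes a lifting of \<open>F\<close>, whereas the transfer of homomorphisms
  needs the same compatibility for F + Id. It follows from \<open>sharp_cop_arr\<close>, since
  \<open>Fb\<close> agrees with \<open>F\<close> on pure morphisms.\<close>

lemma plus_id_lifting:
  assumes "kleisli_lifting C T \<mu> \<eta> F Fb" "X \<in> Obj C" "Y \<in> Obj C" "f \<in> Hom C X Y"
  shows "on_arr (plus_id kl klP Fb) X Y (sharp C T \<eta> X Y f) =
    sharp C T \<eta> (cop P (on_obj F X) X) (cop P (on_obj F Y) Y) (on_arr (plus_id C P F) X Y f)"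
proof -
  interpret kleisli_lifting C T \<mu> \<eta> F Fb by fact
  show ?thesis
    using assms(2-4)
    by (simp add: plus_id_def lift_obj lift_arr sharp_cop_arr base.on_obj_closed base.on_arr_in_hom)
qed

end

section \<open>Action of monad morphisms on saturations and coalgebras\<close>

lemma (in monad) kleisli_ext_in_hom:
  assumes "X \<in> Obj C" "\<alpha> \<in> Hom C X (on_obj S X)"
  shows "kleisli_ext C S m X \<alpha> \<in> Hom C (on_obj S X) (on_obj S X)"
  unfolding kleisli_ext_def
  by (rule comp_in_hom[of _ "on_obj S (on_obj S X)"])
    (use assms in \<open>auto intro: on_obj_closed on_arr_in_hom mult_in_hom\<close>)

text \<open>Functoriality expands the left side to m' \<cdot> S' k \<cdot> S' \<beta> \<cdot> k.
  Naturality of \<open>k\<close> at \<beta> replaces S' \<beta> \<cdot> k by k \<cdot> S \<beta>,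
  and preservation of multiplication replaces m' \<cdot> S' k \<cdot> k by k \<cdot> m.\<close>

lemma (in monad_morphism) kleisli_ext_comp:
  assumes [simp]: "X \<in> Obj C" and \<beta>: "\<beta> \<in> Hom C X (on_obj S X)"
  shows "Comp C (on_obj S X) (on_obj S' X) (on_obj S' X)
      (kleisli_ext C S' m' X (Comp C X (on_obj S X) (on_obj S' X) (k X) \<beta>)) (k X) =
    Comp C (on_obj S X) (on_obj S X) (on_obj S' X) (k X) (kleisli_ext C S m X \<beta>)"
proof -
  let ?S = "on_obj S" and ?S' = "on_obj S'"
  have [simp]: "?S X \<in> Obj C" "?S' X \<in> Obj C" "?S (?S X) \<in> Obj C" "?S' (?S X) \<in> Obj C"
    "?S' (?S' X) \<in> Obj C"
    by (simp_all add: dom.on_obj_closed cod.on_obj_closed)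
  have kX[simp]: "k X \<in> Hom C (?S X) (?S' X)" and [simp]: "k (?S X) \<in> Hom C (?S (?S X)) (?S' (?S X))"
    by (simp_all add: component_in_hom)
  note [simp] = \<beta> dom.mult_in_hom cod.mult_in_hom
  have [simp]: "on_arr S' (?S X) (?S' X) (k X) \<in> Hom C (?S' (?S X)) (?S' (?S' X))"
    "on_arr S' X (?S X) \<beta> \<in> Hom C (?S' X) (?S' (?S X))"
    "on_arr S X (?S X) \<beta> \<in> Hom C (?S X) (?S (?S X))"
    by (simp_all add: cod.on_arr_in_hom dom.on_arr_in_hom)
  note ci = dom.comp_in_hom and as = dom.comp_assoc
  \<comment> \<open>Inner composites whose typing is a side condition of rewriting with
    associativity below.\<close>
  have [simp]: "Comp C (?S' X) (?S' (?S X)) (?S' (?S' X)) (on_arr S' (?S X) (?S' X) (k X))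
      (on_arr S' X (?S X) \<beta>) \<in> Hom C (?S' X) (?S' (?S' X))"
    "Comp C (?S (?S X)) (?S' (?S X)) (?S' (?S' X)) (on_arr S' (?S X) (?S' X) (k X)) (k (?S X))
      \<in> Hom C (?S (?S X)) (?S' (?S' X))"
    by (auto intro: ci[of _ "?S' (?S X)"])
  have "Comp C (?S X) (?S' X) (?S' X)
      (kleisli_ext C S' m' X (Comp C X (?S X) (?S' X) (k X) \<beta>)) (k X) =
    Comp C (?S X) (?S' (?S' X)) (?S' X) (m' X)
      (Comp C (?S X) (?S' (?S X)) (?S' (?S' X)) (on_arr S' (?S X) (?S' X) (k X))
        (Comp C (?S X) (?S' X) (?S' (?S X)) (on_arr S' X (?S X) \<beta>) (k X)))"
    by (simp add: kleisli_ext_def cod.on_arr_comp as)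
  also have "Comp C (?S X) (?S' X) (?S' (?S X)) (on_arr S' X (?S X) \<beta>) (k X) =
      Comp C (?S X) (?S (?S X)) (?S' (?S X)) (k (?S X)) (on_arr S X (?S X) \<beta>)"
    by (simp add: naturality)
  also have "Comp C (?S X) (?S' (?S' X)) (?S' X) (m' X)
      (Comp C (?S X) (?S' (?S X)) (?S' (?S' X)) (on_arr S' (?S X) (?S' X) (k X))
        (Comp C (?S X) (?S (?S X)) (?S' (?S X)) (k (?S X)) (on_arr S X (?S X) \<beta>))) =
    Comp C (?S X) (?S (?S X)) (?S' X)
      (Comp C (?S (?S X)) (?S X) (?S' X) (k X) (m X)) (on_arr S X (?S X) \<beta>)"
    by (simp add: preserves_mult as)
  also have "\<dots> = Comp C (?S X) (?S X) (?S' X) (k X) (kleisli_ext C S m X \<beta>)"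
    by (simp add: kleisli_ext_def as)
  finally show ?thesis .
qed

text \<open>Precompose the intertwining of the two saturated endomorphisms with \<open>e X\<close>
  and use k \<cdot> e = e'. The premise \<open>k_star\<close> is the theorem's hypothesis on
  saturations at the single object \<open>X\<close>.\<close>

lemma (in monad_morphism) saturate_comp:
  assumes X: "X \<in> Obj C" and \<beta>: "\<beta> \<in> Hom C X (on_obj S X)"
    and star: "\<And>Y \<phi>. \<lbrakk>Y \<in> Obj C; \<phi> \<in> Hom C Y Y\<rbrakk> \<Longrightarrow> star Y \<phi> \<in> Hom C Y Y"
    and k_star: "\<And>\<phi> \<psi>. \<lbrakk>\<phi> \<in> Hom C (on_obj S X) (on_obj S X); \<psi> \<in> Hom C (on_obj S' X) (on_obj S' X);
        Comp C (on_obj S X) (on_obj S' X) (on_obj S' X) \<psi> (k X) =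
        Comp C (on_obj S X) (on_obj S X) (on_obj S' X) (k X) \<phi>\<rbrakk> \<Longrightarrow>
        Comp C (on_obj S X) (on_obj S' X) (on_obj S' X) (star (on_obj S' X) \<psi>) (k X) =
        Comp C (on_obj S X) (on_obj S X) (on_obj S' X) (k X) (star (on_obj S X) \<phi>)"
  shows "saturate C star S' m' e' X (Comp C X (on_obj S X) (on_obj S' X) (k X) \<beta>) =
    Comp C X (on_obj S X) (on_obj S' X) (k X) (saturate C star S m e X \<beta>)"
proof -
  let ?S = "on_obj S X" and ?S' = "on_obj S' X"
  let ?\<phi> = "kleisli_ext C S m X \<beta>" and ?\<psi> = "kleisli_ext C S' m' X (Comp C X ?S ?S' (k X) \<beta>)"
  have o: "?S \<in> Obj C" "?S' \<in> Obj C"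
    using X by (simp_all add: dom.on_obj_closed cod.on_obj_closed)
  have k: "k X \<in> Hom C ?S ?S'"
    using X by (rule component_in_hom)
  have \<phi>: "?\<phi> \<in> Hom C ?S ?S"
    using X \<beta> by (rule dom.kleisli_ext_in_hom)
  have \<psi>: "?\<psi> \<in> Hom C ?S' ?S'"
    using X by (rule cod.kleisli_ext_in_hom) (rule dom.comp_in_hom[OF X o \<beta> k])
  have "saturate C star S' m' e' X (Comp C X ?S ?S' (k X) \<beta>) =
      Comp C X ?S' ?S' (star ?S' ?\<psi>) (Comp C X ?S ?S' (k X) (e X))"
    by (simp add: saturate_def preserves_unit X)
  also have "\<dots> = Comp C X ?S ?S' (Comp C ?S ?S' ?S' (star ?S' ?\<psi>) (k X)) (e X)"
    using X o k star[OF o(2) \<psi>] by (simp add: dom.comp_assoc dom.unit_in_hom)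
  \<comment> \<open>The premise of \<open>k_star\<close>, that \<open>k X\<close> intertwines
    \<open>?\<phi>\<close> and \<open>?\<psi>\<close>, is \<open>kleisli_ext_comp\<close>.\<close>
  also have "\<dots> = Comp C X ?S ?S' (Comp C ?S ?S ?S' (k X) (star ?S ?\<phi>)) (e X)"
    by (simp add: k_star[OF \<phi> \<psi> kleisli_ext_comp[OF X \<beta>]])
  also have "\<dots> = Comp C X ?S ?S' (k X) (saturate C star S m e X \<beta>)"
    using X o k star[OF o(1) \<phi>] by (simp add: saturate_def dom.comp_assoc dom.unit_in_hom)
  finally show ?thesis .
qed

text \<open>The homomorphism equation in \<open>C\<close> is a Kleisli equation between composites
  with pure morphisms, to which naturality of \<open>h\<close> at
  \<open>sharp C T \<eta> X Z f\<close> applies. The premises on \<open>S'\<close> are the fragment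
  of a Kleisli lifting that this computation uses. The map \<open>f\<close> stays the same, so that
  a cospan can be reused.\<close>

lemma (in kleisli_lifting) coalgebra_hom_nat_transf:
  assumes S': "\<And>Y. Y \<in> Obj C \<Longrightarrow> on_obj Sb' Y = on_obj S' Y"
      "\<And>Y Z f. \<lbrakk>Y \<in> Obj C; Z \<in> Obj C; f \<in> Hom C Y Z\<rbrakk> \<Longrightarrow> on_arr S' Y Z f \<in> Hom C (on_obj S' Y) (on_obj S' Z)"
      "\<And>Y Z f. \<lbrakk>Y \<in> Obj C; Z \<in> Obj C; f \<in> Hom C Y Z\<rbrakk> \<Longrightarrow>
        on_arr Sb' Y Z (sharp C T \<eta> Y Z f) = sharp C T \<eta> (on_obj S' Y) (on_obj S' Z) (on_arr S' Y Z f)"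
    and h: "nat_transf kl Sb Sb' h"
    and a: "coalgebra C (comp_fun T S) X a" and c: "coalgebra C (comp_fun T S) Z c"
    and hom: "coalgebra_hom C (comp_fun T S) X a Z c f"
  shows "coalgebra_hom C (comp_fun T S')
    X (Comp kl X (on_obj Sb X) (on_obj Sb' X) (h X) a)
    Z (Comp kl Z (on_obj Sb Z) (on_obj Sb' Z) (h Z) c) f"
proof -
  interpret h: nat_transf kl Sb Sb' h by fact
  let ?S = "on_obj S" and ?S' = "on_obj S'" and ?T = "on_obj T" and ?f = "sharp C T \<eta> X Z f"
  have K[simp]: "Obj kl = Obj C" "\<And>Y Z. Hom kl Y Z = Hom C Y (?T Z)"
    by (simp_all add: kleisli_def)
  have X[simp]: "X \<in> Obj C" and Z[simp]: "Z \<in> Obj C" and a[simp]: "a \<in> Hom C X (?T (?S X))"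
    and c[simp]: "c \<in> Hom C Z (?T (?S Z))" and f[simp]: "f \<in> Hom C X Z"
    using a c hom by (simp_all add: coalgebra_def coalgebra_hom_def comp_fun_def)
  have [simp]: "on_obj Sb X = ?S X" "on_obj Sb Z = ?S Z" "on_obj Sb' X = ?S' X" "on_obj Sb' Z = ?S' Z"
    by (simp_all add: lift_obj S')
  have [simp]: "?S X \<in> Obj C" "?S Z \<in> Obj C"
    by (simp_all add: base.on_obj_closed)
  have [simp]: "?S' X \<in> Obj C" "?S' Z \<in> Obj C"
    using h.cod.on_obj_closed[of X] h.cod.on_obj_closed[of Z] by simp_all
  have [simp]: "h X \<in> Hom C (?S X) (?T (?S' X))" "h Z \<in> Hom C (?S Z) (?T (?S' Z))"
    using h.component_in_hom[of X] h.component_in_hom[of Z] by simp_all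
  have ff[simp]: "?f \<in> Hom C X (?T Z)"
    by (simp add: sharp_in_hom)
  have [simp]: "on_arr Sb X Z ?f \<in> Hom C (?S X) (?T (?S Z))"
    using lifted.on_arr_in_hom[of X Z ?f] by simp
  have [simp]: "on_arr Sb' X Z ?f \<in> Hom C (?S' X) (?T (?S' Z))"
    using h.cod.on_arr_in_hom[of X Z ?f] by simp
  have [simp]: "on_arr S X Z f \<in> Hom C (?S X) (?S Z)" "on_arr S' X Z f \<in> Hom C (?S' X) (?S' Z)"
    by (simp_all add: base.on_arr_in_hom S')
  have ha: "Comp kl X (?S X) (?S' X) (h X) a \<in> Hom C X (?T (?S' X))"
    and hc: "Comp kl Z (?S Z) (?S' Z) (h Z) c \<in> Hom C Z (?T (?S' Z))"
    using lifted.comp_in_hom[of X "?S X" "?S' X" a "h X"] lifted.comp_in_hom[of Z "?S Z" "?S' Z" c "h Z"]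
    by simp_all
  \<comment> \<open>Kleisli associativity with \<open>Obj\<close> and \<open>Hom\<close> unfolded,
    matching the simplified typing facts above.\<close>
  have as: "Comp kl W Y V (Comp kl Y U V r q) p = Comp kl W U V r (Comp kl W Y U q p)"
    if "W \<in> Obj C" "Y \<in> Obj C" "U \<in> Obj C" "V \<in> Obj C"
      "p \<in> Hom C W (?T Y)" "q \<in> Hom C Y (?T U)" "r \<in> Hom C U (?T V)" for W Y U V p q r
    using lifted.comp_assoc[of W Y U V p q r] that by simp
  \<comment> \<open>Postcomposition with T (S' f) in \<open>C\<close> is Kleisli composition with
    the pure morphism of S' f, which is \<open>Sb'\<close> applied to \<open>?f\<close>.\<close>
  have "Comp C X (?T (?S' X)) (?T (?S' Z)) (on_arr T (?S' X) (?S' Z) (on_arr S' X Z f))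
        (Comp kl X (?S X) (?S' X) (h X) a) =
      Comp kl X (?S' X) (?S' Z) (on_arr Sb' X Z ?f) (Comp kl X (?S X) (?S' X) (h X) a)"
    using ha by (simp add: S' kleisli_comp_sharp_left)
  also have "\<dots> = Comp kl X (?S X) (?S' Z) (Comp kl (?S X) (?S' X) (?S' Z) (on_arr Sb' X Z ?f) (h X)) a"
    by (simp add: as)
  also have "\<dots> = Comp kl X (?S X) (?S' Z) (Comp kl (?S X) (?S Z) (?S' Z) (h Z) (on_arr Sb X Z ?f)) a"
    using h.naturality[of X Z ?f] by simp
  also have "\<dots> = Comp kl X (?S Z) (?S' Z) (h Z) (Comp kl X (?S X) (?S Z) (on_arr Sb X Z ?f) a)"
    by (simp add: as)
  \<comment> \<open>The homomorphism equation of \<open>f\<close>, read in the Kleisli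
    category.\<close>
  also have "Comp kl X (?S X) (?S Z) (on_arr Sb X Z ?f) a = Comp kl X Z (?S Z) c ?f"
    using hom by (simp add: lift_arr kleisli_comp_sharp_left kleisli_comp_sharp_right
        coalgebra_hom_def comp_fun_def)
  also have "Comp kl X (?S Z) (?S' Z) (h Z) (Comp kl X Z (?S Z) c ?f) =
      Comp kl X Z (?S' Z) (Comp kl Z (?S Z) (?S' Z) (h Z) c) ?f"
    by (simp add: as)
  also have "\<dots> = Comp C X Z (?T (?S' Z)) (Comp kl Z (?S Z) (?S' Z) (h Z) c) f"
    using hc by (simp add: kleisli_comp_sharp_right)
  finally show ?thesis
    by (simp add: coalgebra_hom_def comp_fun_def)
qed

section \<open>Transfer of bisimulations along \<open>h\<close>\<close>

theorem theorem6:
  fixes C K :: "('o, 'a) cat" and P KP :: "('o, 'a) coprod"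
    and T F Fb F\<tau> Fb\<tau> Fs Fbs :: "('o, 'a) endofun"
    and A\<^sub>F :: "('o, 'a) free_algs"
    and \<mu> \<eta> m e m' e' \<nu> h :: "'o \<Rightarrow> 'a"
    and le :: "'o \<Rightarrow> 'o \<Rightarrow> 'a \<Rightarrow> 'a \<Rightarrow> bool"
    and star :: "'o \<Rightarrow> 'a \<Rightarrow> 'a" and zero :: "'o \<Rightarrow> 'o \<Rightarrow> 'a"
    and X R :: 'o and \<alpha> \<alpha>' p\<^sub>1 p\<^sub>2 :: 'a
  assumes coproducts: "binary_coproducts C P"
    and T_saturation: "order_saturation_monad C T \<mu> \<eta> le star"
    and K_def: "K = kleisli C T \<mu> \<eta>"
    and KP_def: "KP = kleisli_coprod C T \<eta> P"
    and zero: "zero_morphisms K zero"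
    and F_lifts: "kleisli_lifting C T \<mu> \<eta> F Fb"
    and F\<tau>_def: "F\<tau> = plus_id C P F"
    and Fb\<tau>_def: "Fb\<tau> = plus_id K KP Fb"
    and e'_def: "e' = tau_unit KP Fb"
    and m'_def: "m' = tau_mult K KP zero Fb"
    and Fb\<tau>_monad: "monad K Fb\<tau> m' e'"
    and free_algebras: "free_algebras C F A\<^sub>F"
    and Fs_def: "Fs = free_fun C F A\<^sub>F"
    and Fs_lifts: "kleisli_lifting C T \<mu> \<eta> Fs Fbs"
    and Fbs_free: "free_monad K Fb Fbs m e \<nu>"
    and Fb\<tau>_monotonic: "locally_monotonic K le Fb\<tau>"
    and Fb\<tau>_compatible: "saturation_compatible K star Fb\<tau> m' e'"
    and Fbs_monotonic: "locally_monotonic K le Fbs"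
    and Fbs_compatible: "saturation_compatible K star Fbs m e"
    and h_morphism: "monad_morphism K Fbs m e Fb\<tau> m' e' h"
    and h_\<nu>: "\<forall>Y\<in>Obj K. Comp K (on_obj Fb Y) (on_obj Fbs Y) (on_obj Fb\<tau> Y) (h Y) (\<nu> Y) =
                inj1 KP (on_obj Fb Y) Y"
    and h_star: "\<forall>Y\<in>Obj K. \<forall>\<phi>\<in>Hom K (on_obj Fbs Y) (on_obj Fbs Y).
        \<forall>\<psi>\<in>Hom K (on_obj Fb\<tau> Y) (on_obj Fb\<tau> Y).
          Comp K (on_obj Fbs Y) (on_obj Fb\<tau> Y) (on_obj Fb\<tau> Y) \<psi> (h Y) =
          Comp K (on_obj Fbs Y) (on_obj Fbs Y) (on_obj Fb\<tau> Y) (h Y) \<phi> \<longrightarrow>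
          Comp K (on_obj Fbs Y) (on_obj Fb\<tau> Y) (on_obj Fb\<tau> Y) (star (on_obj Fb\<tau> Y) \<psi>) (h Y) =
          Comp K (on_obj Fbs Y) (on_obj Fbs Y) (on_obj Fb\<tau> Y) (h Y) (star (on_obj Fbs Y) \<phi>)"
    and X_obj: "X \<in> Obj K"
    and \<alpha>_hom: "\<alpha> \<in> Hom K X (on_obj Fb\<tau> X)"
    and \<alpha>'_def: "\<alpha>' = Comp K X (on_obj Fb\<tau> X) (on_obj Fbs X)
        (cotuple K KP (on_obj Fb X) X (on_obj Fbs X) (\<nu> X) (e X)) \<alpha>"
    and bisim: "bisimulation C (comp_fun T Fs)
        X (saturate K star Fbs m e X \<alpha>') X (saturate K star Fbs m e X \<alpha>') R p\<^sub>1 p\<^sub>2"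
  shows "bisimulation C (comp_fun T F\<tau>)
        X (saturate K star Fb\<tau> m' e' X \<alpha>) X (saturate K star Fb\<tau> m' e' X \<alpha>) R p\<^sub>1 p\<^sub>2"
proof -
  interpret osm: order_saturation_monad C T \<mu> \<eta> le star by fact
  interpret cp: binary_coproducts C P by fact
  interpret mc: monad_with_coproducts C T \<mu> \<eta> P ..
  interpret F: kleisli_lifting C T \<mu> \<eta> F Fb by fact
  interpret Fs: kleisli_lifting C T \<mu> \<eta> Fs Fbs by fact
  interpret h: monad_morphism K Fbs m e Fb\<tau> m' e' h by fact
  interpret \<nu>: free_monad K Fb Fbs m e \<nu> by fact
  interpret kcp: binary_coproducts K KP
    unfolding K_def KP_def by (rule mc.binary_coproducts_kleisli) unfold_locales
  have [simp]: "Obj K = Obj C" "\<And>Y Z. Hom K Y Z = Hom C Y (on_obj T Z)" "cop KP = cop P"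
    by (simp_all add: K_def KP_def kleisli_def kleisli_coprod_def)
  have X[simp]: "X \<in> Obj C"
    using X_obj by simp
  have Fb\<tau>_obj: "on_obj Fb\<tau> Y = on_obj F\<tau> Y" if "Y \<in> Obj C" for Y
    using that by (simp add: Fb\<tau>_def F\<tau>_def plus_id_def F.lift_obj)
  have o[simp]: "on_obj Fb Y \<in> Obj C" "on_obj Fbs Y \<in> Obj C" "on_obj Fb\<tau> Y \<in> Obj C" if "Y \<in> Obj C" for Y
    using that \<nu>.dom.on_obj_closed h.dom.on_obj_closed h.cod.on_obj_closed by simp_all
  \<comment> \<open>The map [\<nu>, e], soon seen to be a section of \<open>h X\<close>; by
    definition \<open>\<alpha>'\<close> is \<open>?j\<close> after \<alpha>.\<close>
  let ?j = "cotuple K KP (on_obj Fb X) X (on_obj Fbs X) (\<nu> X) (e X)"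
  have \<nu>X: "\<nu> X \<in> Hom K (on_obj Fb X) (on_obj Fbs X)" and eX: "e X \<in> Hom K X (on_obj Fbs X)"
    and hX: "h X \<in> Hom K (on_obj Fbs X) (on_obj Fb\<tau> X)"
    using \<nu>.component_in_hom[OF X_obj] h.dom.unit_in_hom[OF X_obj] h.component_in_hom[OF X_obj] by simp_all
  have Fb\<tau>X: "on_obj Fb\<tau> X = cop KP (on_obj Fb X) X"
    by (simp add: Fb\<tau>_def plus_id_def)
  have j: "?j \<in> Hom K (on_obj Fb\<tau> X) (on_obj Fbs X)"
    unfolding Fb\<tau>X by (rule kcp.cotuple_in_hom) (use \<nu>X eX in simp_all)
  \<comment> \<open>Composing \<open>h X\<close> with the cotuple gives
    [h \<cdot> \<nu>, h \<cdot> e] = [inj1, e']. As \<open>e'\<close> is the second injection, this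
    is the identity.\<close>
  have hj: "Comp K (on_obj Fb\<tau> X) (on_obj Fbs X) (on_obj Fb\<tau> X) (h X) ?j = Ident K (on_obj Fb\<tau> X)"
  proof -
    have "Comp K (cop KP (on_obj Fb X) X) (on_obj Fbs X) (on_obj Fb\<tau> X) (h X) ?j =
        cotuple K KP (on_obj Fb X) X (on_obj Fb\<tau> X) (inj1 KP (on_obj Fb X) X) (e' X)"
      using kcp.comp_cotuple[of "on_obj Fb X" X "on_obj Fbs X" "on_obj Fb\<tau> X" "\<nu> X" "e X" "h X"]
        \<nu>X eX hX h_\<nu> h.preserves_unit by simp
    then show ?thesis
      using kcp.cotuple_injections[of "on_obj Fb X" X] by (simp add: Fb\<tau>X e'_def tau_unit_def)
  qed
  have \<alpha>': "\<alpha>' \<in> Hom K X (on_obj Fbs X)"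
    unfolding \<alpha>'_def by (rule h.dom.comp_in_hom) (use j \<alpha>_hom in simp_all)
  have "Comp K X (on_obj Fbs X) (on_obj Fb\<tau> X) (h X) \<alpha>' =
      Comp K X (on_obj Fb\<tau> X) (on_obj Fb\<tau> X) (Ident K (on_obj Fb\<tau> X)) \<alpha>"
    unfolding \<alpha>'_def hj[symmetric] using j hX \<alpha>_hom by (subst h.dom.comp_assoc) simp_all
  also have "\<dots> = \<alpha>"
    using \<alpha>_hom by (subst h.dom.comp_ident_left) simp_all
  finally have h\<alpha>': "Comp K X (on_obj Fbs X) (on_obj Fb\<tau> X) (h X) \<alpha>' = \<alpha>" .
  let ?a = "saturate K star Fbs m e X \<alpha>'" and ?b = "saturate K star Fb\<tau> m' e' X \<alpha>"
  have star: "star Y \<phi> \<in> Hom K Y Y" if "Y \<in> Obj K" "\<phi> \<in> Hom K Y Y" for Y \<phi>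
    using osm.star_in_hom[of Y \<phi>] that by (simp add: K_def[symmetric])
  \<comment> \<open>An instance of \<open>saturate_comp\<close> at \<open>\<alpha>'\<close>, where
    \<open>h\<alpha>'\<close> turns h \<cdot> \<alpha>' back into \<alpha>.\<close>
  have b: "?b = Comp K X (on_obj Fbs X) (on_obj Fb\<tau> X) (h X) ?a"
    using h.saturate_comp[OF X_obj \<alpha>', of star] star h_star X_obj unfolding h\<alpha>' by blast
  have push_coalg: "coalgebra C (comp_fun T F\<tau>) Y (Comp K Y (on_obj Fbs Y) (on_obj Fb\<tau> Y) (h Y) c)"
    if "coalgebra C (comp_fun T Fs) Y c" for Y c
  proof -
    have Y: "Y \<in> Obj C" and c: "c \<in> Hom K Y (on_obj Fbs Y)"
      using that by (simp_all add: coalgebra_def comp_fun_def Fs.lift_obj)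
    have "Comp K Y (on_obj Fbs Y) (on_obj Fb\<tau> Y) (h Y) c \<in> Hom K Y (on_obj Fb\<tau> Y)"
      by (rule h.dom.comp_in_hom) (use Y c h.component_in_hom[of Y] in simp_all)
    then show ?thesis
      using Y by (simp add: coalgebra_def comp_fun_def Fb\<tau>_obj)
  qed
  \<comment> \<open>Together with \<open>Fb\<tau>_obj\<close> and \<open>lift\<close>, this gives
    the premises on the target functor in \<open>coalgebra_hom_nat_transf\<close>.\<close>
  have arr: "on_arr F\<tau> Y Z f \<in> Hom C (on_obj F\<tau> Y) (on_obj F\<tau> Z)"
    if "Y \<in> Obj C" "Z \<in> Obj C" "f \<in> Hom C Y Z" for Y Z f
    unfolding F\<tau>_def plus_id_def cop_arr_def endofun.simps
    by (intro cp.cotuple_in_hom osm.comp_in_hom[of _ "on_obj F Z"] osm.comp_in_hom[of Y Z] cp.inj1_in_hom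
        cp.inj2_in_hom cp.cop_closed)
      (use that in \<open>simp_all add: F.base.on_obj_closed F.base.on_arr_in_hom\<close>)
  have lift: "on_arr Fb\<tau> Y Z (sharp C T \<eta> Y Z f) =
      sharp C T \<eta> (on_obj F\<tau> Y) (on_obj F\<tau> Z) (on_arr F\<tau> Y Z f)"
    if "Y \<in> Obj C" "Z \<in> Obj C" "f \<in> Hom C Y Z" for Y Z f
    using mc.plus_id_lifting[OF F_lifts that] unfolding Fb\<tau>_def F\<tau>_def K_def KP_def
    by (simp add: plus_id_def)
  have h_nat: "nat_transf (kleisli C T \<mu> \<eta>) Fbs Fb\<tau> h"
    using h.nat_transf_axioms by (simp add: K_def)
  have push_hom: "coalgebra_hom C (comp_fun T F\<tau>)
      X (Comp K X (on_obj Fbs X) (on_obj Fb\<tau> X) (h X) a)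
      Z (Comp K Z (on_obj Fbs Z) (on_obj Fb\<tau> Z) (h Z) c) f"
    if "coalgebra C (comp_fun T Fs) X a" "coalgebra C (comp_fun T Fs) Z c"
      "coalgebra_hom C (comp_fun T Fs) X a Z c f" for a Z c f
    unfolding K_def
    by (rule Fs.coalgebra_hom_nat_transf[OF _ _ _ h_nat that]) (simp_all add: Fb\<tau>_obj arr lift)
  obtain Z c f g where c: "coalgebra C (comp_fun T Fs) Z c"
    and f: "coalgebra_hom C (comp_fun T Fs) X ?a Z c f"
    and g: "coalgebra_hom C (comp_fun T Fs) X ?a Z c g"
    and pb: "is_pullback C X X Z f g R p\<^sub>1 p\<^sub>2"
    and a: "coalgebra C (comp_fun T Fs) X ?a" and jm: "jointly_monic_span C X X R p\<^sub>1 p\<^sub>2"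
    using bisim unfolding bisimulation_def by blast
  \<comment> \<open>The witnesses are the same object \<open>Z\<close> and maps \<open>f\<close>,
    \<open>g\<close>, with the structure \<open>c\<close> composed with \<open>h Z\<close>. The
    pullback and joint monicity conditions mention only the underlying maps in \<open>C\<close>, so
    \<open>pb\<close> and \<open>jm\<close> apply unchanged.\<close>
  show ?thesis
    unfolding bisimulation_def b
    using push_coalg[OF a] push_coalg[OF c] push_hom[OF a c f] push_hom[OF a c g] pb jm by blast
qed

end
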